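(* Let $0<p<1$. Consider a row of $n\ge1$ seats with two entrances, one at each end, filled by $p$-courteous theatregoers who choose seats uniformly at random among the accessible empty seats (model described in the context). The expected number $F_n$ of occupied seats when the process ends is $$F_n=-\frac{1-p^n}{1-p}+2\sum_{k=1}^n\frac{1-p^k}{k(1-p)}.$$ In particular, for fixed $p$, $F_n=-\frac{1}{1-p}+2\,\frac{H_n+\ln(1-p)}{1-p}+o(1)$ as $n\to\infty$, where $H_n=\sum_{k=1}^n\frac1k$.
   Context: Row model: a row consists of $n$ seats numbered $1,\dots,n$ from left to right, with entrances at both ends. Theatregoers arrive one at a time. Each theatregoer is, independently of all others, courteous with probability $p$ and selfish with probability $1-p$ ("$p$-courteous"), and this status never changes. A seated selfish theatregoer never gets up, so no later theatregoer can walk past her seat; a seated courteous theatregoer always gets up to let others pass and so never blocks. An empty seat is accessible if it can be reached from some entrance without passing a seat occupied by a selfish theatregoer. Each arriving theatregoer sits in an accessible empty seat chosen uniformly at random among all accessible empty seats; the process ends when no accessible empty seat remains. *)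

theory Defs
  imports "HOL-Probability.Probability" "HOL-Library.Landau_Symbols"
begin

datatype manner = Courteous | Selfish

text \<open>A configuration maps each seat to \<^const>\<open>None\<close> if it is empty, and otherwise to the
  manner of its occupant. Only the seats in \<open>{1..n}\<close> belong to the row.\<close>

type_synonym config = "nat \<Rightarrow> manner option"

definition accessible :: "nat \<Rightarrow> config \<Rightarrow> nat set" where
  "accessible n c = {i \<in> {1..n}. c i = None \<and>
     ((\<forall>j\<in>{1..<i}. c j \<noteq> Some Selfish) \<or> (\<forall>j\<in>{i<..n}. c j \<noteq> Some Selfish))}"

definition occupied :: "nat \<Rightarrow> config \<Rightarrow> nat set" where
  "occupied n c = {i \<in> {1..n}. c i \<noteq> None}"

definition manner_pmf :: "real \<Rightarrow> manner pmf" where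
  "manner_pmf p = map_pmf (\<lambda>b. if b then Courteous else Selfish) (bernoulli_pmf p)"

text \<open>The distribution of the final configuration when the process is continued from \<open>c\<close>.
  The manner of a theatregoer is drawn, independently of everything before, on arrival;
  it does not influence which seat she takes.\<close>

function final_config :: "nat \<Rightarrow> real \<Rightarrow> config \<Rightarrow> config pmf" where
  "final_config n p c =
     (if accessible n c = {} then return_pmf c
      else bind_pmf (pmf_of_set (accessible n c)) (\<lambda>i.
             bind_pmf (manner_pmf p) (\<lambda>m.
               final_config n p (c(i \<mapsto> m)))))"
  by pat_completeness auto
termination
proof (relation "Wellfounded.measure (\<lambda>(n, p, c). card {i \<in> {1..n}. c i = None})", goal_cases)
  case 1
  show ?case by (rule wf_measure)
next
  case (2 n p c i m)
  have fin: "finite (accessible n c)"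
    by (simp add: accessible_def)
  have "i \<in> accessible n c"
    using 2(2) unfolding set_pmf_of_set[OF 2(1) fin] .
  then have i: "i \<in> {1..n}" "c i = None"
    unfolding accessible_def by blast+
  have "card {j \<in> {1..n}. (c(i \<mapsto> m)) j = None} < card {j \<in> {1..n}. c j = None}"
  proof (rule psubset_card_mono)
    show "{j \<in> {1..n}. (c(i \<mapsto> m)) j = None} \<subset> {j \<in> {1..n}. c j = None}"
    proof (rule psubsetI)
      show "{j \<in> {1..n}. (c(i \<mapsto> m)) j = None} \<subseteq> {j \<in> {1..n}. c j = None}"
        by (auto simp: fun_upd_def split: if_splits)
      have "i \<notin> {j \<in> {1..n}. (c(i \<mapsto> m)) j = None}" by simp
      with i show "{j \<in> {1..n}. (c(i \<mapsto> m)) j = None} \<noteq> {j \<in> {1..n}. c j = None}"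
        by blast
    qed
  qed simp
  then show ?case
    by (simp only: in_measure case_prod_conv)
qed

declare final_config.simps [simp del]

definition expected_occupied :: "real \<Rightarrow> nat \<Rightarrow> real" where
  "expected_occupied p n =
     measure_pmf.expectation (final_config n p (\<lambda>_. None)) (\<lambda>c. real (card (occupied n c)))"

end

theory Submission
  imports Defs
begin

text \<open>
  Once a selfish theatregoer is seated, the accessible empty seats split into those to the left of
  all selfish people and those to the right of all selfish people, and these two groups evolve as
  independent one-entrance rows. If \<open>g a\<close> denotes the expected number of further arrivals for
  \<open>a\<close> empty seats with one entrance, then
  \<open>a * g a = a + p * a * g (a - 1) + (1 - p) * (g 0 + ... + g (a - 1))\<close>, and subtracting
  consecutive instances shows that \<open>d a = a * (g a - g (a - 1))\<close> satisfies
  \<open>d a = 1 + p * d (a - 1)\<close>, so \<open>d a = (1 - p^a) / (1 - p)\<close>. As long as nobody selfish is seated,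
  the corresponding quantity \<open>f\<close> satisfies \<open>f k - 2 * g k = - 1 + p * (f (k - 1) - 2 * g (k - 1))\<close>,
  which gives \<open>f k = 2 * g k - (1 - p^k) / (1 - p)\<close>. The resulting value function of a
  configuration is preserved on average by each arrival.
\<close>

subsection \<open>The recursions for one and two entrances\<close>

definition one_entrance_mean :: "real \<Rightarrow> nat \<Rightarrow> real" where
  "one_entrance_mean p a = (\<Sum>k=1..a. (1 - p ^ k) / (real k * (1 - p)))"

definition two_entrance_mean :: "real \<Rightarrow> nat \<Rightarrow> real" where
  "two_entrance_mean p k = - ((1 - p ^ k) / (1 - p)) + 2 * one_entrance_mean p k"

lemma one_entrance_mean_0 [simp]: "one_entrance_mean p 0 = 0"
  by (simp add: one_entrance_mean_def)

lemma two_entrance_mean_0 [simp]: "two_entrance_mean p 0 = 0"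
  by (simp add: two_entrance_mean_def)

lemma one_entrance_mean_Suc:
  "one_entrance_mean p (Suc a) = one_entrance_mean p a + (1 - p ^ Suc a) / (real (Suc a) * (1 - p))"
  by (simp add: one_entrance_mean_def)

lemma one_entrance_mean_increment:
  assumes "p \<noteq> 1"
  shows "real (Suc a) * (one_entrance_mean p (Suc a) - one_entrance_mean p a) = (1 - p ^ Suc a) / (1 - p)"
  unfolding one_entrance_mean_Suc by (simp del: power_Suc of_nat_Suc)

text \<open>First-arrival equation, multiplied by \<open>a\<close>: a courteous arrival leaves
  \<open>a - 1\<close> open seats wherever she sits; a selfish one leaves only the \<open>j\<close>
  seats on the entrance side of her, each \<open>j < a\<close> being equally likely.\<close>

lemma one_entrance_mean_recursion:
  assumes "p \<noteq> 1"
  shows "real a * one_entrance_mean p a =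
    real a + p * real a * one_entrance_mean p (a - 1) + (1 - p) * (\<Sum>j<a. one_entrance_mean p j)"
proof (induction a)
  case (Suc a)
  show ?case
  proof (cases a)
    case 0
    then show ?thesis using assms by (simp add: one_entrance_mean_Suc)
  next
    case (Suc b)
    let ?g = "one_entrance_mean p"
    define d where "d = real a * (?g a - ?g b)"
    define d' where "d' = real (Suc a) * (?g (Suc a) - ?g a)"
    have d: "d = (1 - p ^ a) / (1 - p)" "d' = (1 - p ^ Suc a) / (1 - p)"
      unfolding d_def d'_def Suc by (rule one_entrance_mean_increment[OF assms])+
    have "d' = 1 + p * d"
      unfolding d using assms by (simp add: field_simps)
    \<comment> \<open>The claim for \<open>Suc a\<close> minus the claim for \<open>a\<close>
      rearranges to exactly \<open>d' = 1 + p * d\<close>.\<close>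
    then show ?thesis
      using Suc.IH unfolding d_def d'_def by (simp add: Suc algebra_simps)
  qed
qed simp

text \<open>A selfish arrival leaves a one-entrance row on each side of her; summed over her
  position both sides give the same total, hence the factor 2.\<close>

lemma two_entrance_mean_recursion:
  assumes "p \<noteq> 1"
  shows "real k * two_entrance_mean p k =
    real k + p * real k * two_entrance_mean p (k - 1) + 2 * (1 - p) * (\<Sum>j<k. one_entrance_mean p j)"
proof (cases k)
  case (Suc m)
  have "(1 - p ^ Suc m) / (1 - p) = 1 + p * ((1 - p ^ m) / (1 - p))"
    using assms by (simp add: field_simps)
  then have "two_entrance_mean p (Suc m) - 2 * one_entrance_mean p (Suc m) =
      - 1 + p * (two_entrance_mean p m - 2 * one_entrance_mean p m)"
    by (simp add: two_entrance_mean_def)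
  then have "real k * (two_entrance_mean p k - 2 * one_entrance_mean p k) =
      real k * (- 1 + p * (two_entrance_mean p m - 2 * one_entrance_mean p m))"
    by (simp only: Suc)
  then show ?thesis
    using one_entrance_mean_recursion[OF assms, of k] by (simp add: Suc algebra_simps)
qed simp

subsection \<open>Sums over ranks in a finite set\<close>

text \<open>The ranks of the elements of \<open>A\<close> run once through
  \<open>0, ..., card A - 1\<close>. This turns a sum over arbitrarily scattered open seats into the
  index sum of the recursions.\<close>

lemma sum_card_below:
  fixes A :: "'a::linorder set" and g :: "nat \<Rightarrow> 'b::comm_monoid_add"
  assumes "finite A"
  shows "(\<Sum>i\<in>A. g (card {j\<in>A. j < i})) = (\<Sum>k<card A. g k)"
  using assms
proof (induction A rule: finite_linorder_max_induct)
  case (insert b A)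
  have "{j \<in> insert b A. j < b} = A"
    using insert by auto
  moreover have "{j \<in> insert b A. j < i} = {j\<in>A. j < i}" if "i \<in> A" for i
    using insert that by force
  moreover have "b \<notin> A" using insert by auto
  ultimately show ?case
    using insert by (simp add: add.commute)
qed simp

lemma sum_card_above:
  fixes A :: "'a::linorder set" and g :: "nat \<Rightarrow> 'b::comm_monoid_add"
  assumes "finite A"
  shows "(\<Sum>i\<in>A. g (card {j\<in>A. i < j})) = (\<Sum>k<card A. g k)"
  using assms
proof (induction A rule: finite_linorder_min_induct)
  case (insert b A)
  have "{j \<in> insert b A. b < j} = A"
    using insert by auto
  moreover have "{j \<in> insert b A. i < j} = {j\<in>A. i < j}" if "i \<in> A" for i
    using insert that by force
  moreover have "b \<notin> A" using insert by auto
  ultimately show ?case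
    using insert by (simp add: add.commute)
qed simp

subsection \<open>Seats accessible from either side\<close>

definition left_accessible :: "nat \<Rightarrow> config \<Rightarrow> nat set" where
  "left_accessible n c = {i \<in> {1..n}. c i = None \<and> (\<forall>j\<in>{1..<i}. c j \<noteq> Some Selfish)}"

definition right_accessible :: "nat \<Rightarrow> config \<Rightarrow> nat set" where
  "right_accessible n c = {i \<in> {1..n}. c i = None \<and> (\<forall>j\<in>{i<..n}. c j \<noteq> Some Selfish)}"

definition no_selfish :: "nat \<Rightarrow> config \<Rightarrow> bool" where
  "no_selfish n c \<longleftrightarrow> (\<forall>j\<in>{1..n}. c j \<noteq> Some Selfish)"

lemma finite_left_accessible [simp]: "finite (left_accessible n c)"
  by (simp add: left_accessible_def)

lemma finite_right_accessible [simp]: "finite (right_accessible n c)"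
  by (simp add: right_accessible_def)

lemma finite_accessible [simp]: "finite (accessible n c)"
  by (simp add: accessible_def)

lemma accessible_eq_Un: "accessible n c = left_accessible n c \<union> right_accessible n c"
  by (auto simp: accessible_def left_accessible_def right_accessible_def)

lemma no_selfish_accessible:
  assumes "no_selfish n c"
  shows "left_accessible n c = accessible n c" "right_accessible n c = accessible n c"
  using assms by (auto simp: accessible_def left_accessible_def right_accessible_def no_selfish_def)

text \<open>Any selfish seat \<open>s\<close> separates the two sets.\<close>

lemma left_accessible_less_right_accessible:
  assumes "\<not> no_selfish n c" "i \<in> left_accessible n c" "j \<in> right_accessible n c"
  shows "i < j"
proof -
  from assms(1) obtain s where s: "s \<in> {1..n}" "c s = Some Selfish"
    by (auto simp: no_selfish_def)
  have "i < s"
    using assms(2) s by (cases "i = s") (force simp: left_accessible_def)+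
  moreover have "s < j"
    using assms(3) s by (cases "j = s") (force simp: right_accessible_def)+
  ultimately show ?thesis by simp
qed

lemma accessible_courteous:
  assumes "c i = None"
  shows "left_accessible n (c(i \<mapsto> Courteous)) = left_accessible n c - {i}"
    "right_accessible n (c(i \<mapsto> Courteous)) = right_accessible n c - {i}"
    "accessible n (c(i \<mapsto> Courteous)) = accessible n c - {i}"
    "no_selfish n (c(i \<mapsto> Courteous)) = no_selfish n c"
  using assms by (auto simp: accessible_def left_accessible_def right_accessible_def no_selfish_def)

text \<open>From the left only seats before \<open>i\<close> survive, from the right only those
  after it; this holds whether or not someone selfish sat before.\<close>

lemma accessible_selfish:
  assumes "i \<in> {1..n}" "c i = None"
  shows "left_accessible n (c(i \<mapsto> Selfish)) = {j \<in> left_accessible n c. j < i}"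
    "right_accessible n (c(i \<mapsto> Selfish)) = {j \<in> right_accessible n c. i < j}"
    "\<not> no_selfish n (c(i \<mapsto> Selfish))"
  using assms
  by (auto simp: left_accessible_def right_accessible_def no_selfish_def not_less le_less)

lemma card_occupied_upd:
  assumes "i \<in> {1..n}" "c i = None"
  shows "card (occupied n (c(i \<mapsto> m))) = Suc (card (occupied n c))"
proof -
  have "occupied n (c(i \<mapsto> m)) = insert i (occupied n c)" "i \<notin> occupied n c" "finite (occupied n c)"
    using assms by (auto simp: occupied_def)
  then show ?thesis by simp
qed

lemma card_occupied_le: "card (occupied n c) \<le> n"
proof -
  have "card (occupied n c) \<le> card {1..n}"
    by (rule card_mono) (auto simp: occupied_def)
  then show ?thesis by simp
qed

subsection \<open>The value function\<close>

text \<open>Candidate for the expected number of further arrivals. While nobody is selfish the left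
  and right sets coincide, so adding two one-entrance values would count every seat twice.\<close>

definition remaining_mean :: "nat \<Rightarrow> real \<Rightarrow> config \<Rightarrow> real" where
  "remaining_mean n p c =
     (if no_selfish n c then two_entrance_mean p (card (accessible n c))
      else one_entrance_mean p (card (left_accessible n c)) +
           one_entrance_mean p (card (right_accessible n c)))"

text \<open>One-step balance: averaged over the next arrival, \<open>remaining_mean\<close> drops by
  1, which offsets the seat just taken. Multiplying by the number of open seats avoids a
  division.\<close>

lemma remaining_mean_step_no_selfish:
  assumes "p \<noteq> 1" "no_selfish n c"
  shows "(\<Sum>i\<in>accessible n c. p * remaining_mean n p (c(i \<mapsto> Courteous)) +
            (1 - p) * remaining_mean n p (c(i \<mapsto> Selfish))) =
         real (card (accessible n c)) * (remaining_mean n p c - 1)"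
proof -
  let ?A = "accessible n c" and ?g = "one_entrance_mean p"
  have "(\<Sum>i\<in>?A. p * remaining_mean n p (c(i \<mapsto> Courteous)) +
            (1 - p) * remaining_mean n p (c(i \<mapsto> Selfish))) =
        (\<Sum>i\<in>?A. p * two_entrance_mean p (card ?A - 1) +
            (1 - p) * (?g (card {j\<in>?A. j < i}) + ?g (card {j\<in>?A. i < j})))"
  proof (rule sum.cong)
    fix i assume i: "i \<in> ?A"
    then have "i \<in> {1..n}" "c i = None" by (auto simp: accessible_def)
    then show "p * remaining_mean n p (c(i \<mapsto> Courteous)) +
            (1 - p) * remaining_mean n p (c(i \<mapsto> Selfish)) =
        p * two_entrance_mean p (card ?A - 1) +
            (1 - p) * (?g (card {j\<in>?A. j < i}) + ?g (card {j\<in>?A. i < j}))"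
      using i assms(2)
      by (simp add: remaining_mean_def accessible_courteous accessible_selfish no_selfish_accessible)
  qed simp
  also have "\<dots> = p * real (card ?A) * two_entrance_mean p (card ?A - 1) +
      2 * (1 - p) * (\<Sum>j<card ?A. ?g j)"
    unfolding sum.distrib sum_distrib_left[symmetric] sum_card_below[OF finite_accessible] sum_card_above[OF finite_accessible]
    by (simp add: algebra_simps)
  also have "\<dots> = real (card ?A) * (remaining_mean n p c - 1)"
    using two_entrance_mean_recursion[OF assms(1), of "card ?A"] assms(2)
    by (simp add: remaining_mean_def algebra_simps)
  finally show ?thesis .
qed

lemma remaining_mean_step_selfish:
  assumes "p \<noteq> 1" "\<not> no_selfish n c"
  shows "(\<Sum>i\<in>accessible n c. p * remaining_mean n p (c(i \<mapsto> Courteous)) +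
            (1 - p) * remaining_mean n p (c(i \<mapsto> Selfish))) =
         real (card (accessible n c)) * (remaining_mean n p c - 1)"
proof -
  let ?L = "left_accessible n c" and ?R = "right_accessible n c" and ?g = "one_entrance_mean p"
  let ?t = "\<lambda>i. p * remaining_mean n p (c(i \<mapsto> Courteous)) +
            (1 - p) * remaining_mean n p (c(i \<mapsto> Selfish))"
  note less = left_accessible_less_right_accessible[OF assms(2)]
  have disj: "?L \<inter> ?R = {}"
    using less by blast
  have "sum ?t ?L = (\<Sum>i\<in>?L. p * (?g (card ?L - 1) + ?g (card ?R)) +
            (1 - p) * (?g (card {j\<in>?L. j < i}) + ?g (card ?R)))"
  proof (rule sum.cong)
    fix i assume i: "i \<in> ?L"
    then have "i \<in> {1..n}" "c i = None" by (auto simp: left_accessible_def)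
    \<comment> \<open>An arrival on the left side, of either manner, leaves the right side
      unchanged.\<close>
    moreover have "i \<notin> ?R" "{j\<in>?R. i < j} = ?R"
      using i less by blast+
    ultimately show "?t i = p * (?g (card ?L - 1) + ?g (card ?R)) +
            (1 - p) * (?g (card {j\<in>?L. j < i}) + ?g (card ?R))"
      using i assms(2) by (simp add: remaining_mean_def accessible_courteous accessible_selfish)
  qed simp
  also have "\<dots> = p * real (card ?L) * ?g (card ?L - 1) + (1 - p) * (\<Sum>j<card ?L. ?g j) +
      real (card ?L) * ?g (card ?R)"
    unfolding sum.distrib sum_distrib_left[symmetric] sum_card_below[OF finite_left_accessible]
    by (simp add: algebra_simps)
  also have "\<dots> = real (card ?L) * (?g (card ?L) + ?g (card ?R) - 1)"
    using one_entrance_mean_recursion[OF assms(1), of "card ?L"] by (simp add: algebra_simps)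
  finally have L: "sum ?t ?L = real (card ?L) * (?g (card ?L) + ?g (card ?R) - 1)" .
  have "sum ?t ?R = (\<Sum>i\<in>?R. p * (?g (card ?L) + ?g (card ?R - 1)) +
            (1 - p) * (?g (card ?L) + ?g (card {j\<in>?R. i < j})))"
  proof (rule sum.cong)
    fix i assume i: "i \<in> ?R"
    then have "i \<in> {1..n}" "c i = None" by (auto simp: right_accessible_def)
    moreover have "i \<notin> ?L" "{j\<in>?L. j < i} = ?L"
      using i less by blast+
    ultimately show "?t i = p * (?g (card ?L) + ?g (card ?R - 1)) +
            (1 - p) * (?g (card ?L) + ?g (card {j\<in>?R. i < j}))"
      using i assms(2) by (simp add: remaining_mean_def accessible_courteous accessible_selfish)
  qed simp
  also have "\<dots> = p * real (card ?R) * ?g (card ?R - 1) + (1 - p) * (\<Sum>j<card ?R. ?g j) +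
      real (card ?R) * ?g (card ?L)"
    unfolding sum.distrib sum_distrib_left[symmetric] sum_card_above[OF finite_right_accessible]
    by (simp add: algebra_simps)
  also have "\<dots> = real (card ?R) * (?g (card ?L) + ?g (card ?R) - 1)"
    using one_entrance_mean_recursion[OF assms(1), of "card ?R"] by (simp add: algebra_simps)
  finally have R: "sum ?t ?R = real (card ?R) * (?g (card ?L) + ?g (card ?R) - 1)" .
  have "sum ?t (accessible n c) = sum ?t ?L + sum ?t ?R"
    unfolding accessible_eq_Un by (intro sum.union_disjoint disj) simp_all
  also have "\<dots> = real (card (accessible n c)) * (remaining_mean n p c - 1)"
    using assms(2) disj unfolding L R
    by (simp add: accessible_eq_Un card_Un_disjoint remaining_mean_def algebra_simps)
  finally show ?thesis .
qed

section \<open>Expectation of the final configuration\<close>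

text \<open>Boundedness supplies the integrability needed for the tower rule; seat counts are
  bounded by \<open>n\<close>.\<close>

lemma expectation_bind_pmf_bounded:
  fixes f :: "'b \<Rightarrow> real"
  assumes "\<And>x. \<bar>f x\<bar> \<le> B"
  shows "measure_pmf.expectation (bind_pmf M N) f =
    measure_pmf.expectation M (\<lambda>x. measure_pmf.expectation (N x) f)"
  unfolding measure_pmf_bind
  by (rule integral_bind[where K = "count_space UNIV" and B = B and B' = 1])
    (use assms measurable_measure_pmf[of N] in
      \<open>auto simp: measure_pmf.finite_measure_axioms measure_pmf.emeasure_space_1\<close>)

lemma expectation_manner_pmf:
  fixes f :: "manner \<Rightarrow> real"
  assumes "0 \<le> p" "p \<le> 1"
  shows "measure_pmf.expectation (manner_pmf p) f = p * f Courteous + (1 - p) * f Selfish"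
  using assms by (simp add: manner_pmf_def)

text \<open>Occupied seats plus \<open>remaining_mean\<close> is preserved on average by each
  arrival, and \<open>remaining_mean\<close> vanishes once no seat is accessible.\<close>

lemma expectation_final_config:
  assumes "0 \<le> p" "p < 1"
  shows "measure_pmf.expectation (final_config n p c) (\<lambda>c. real (card (occupied n c))) =
    real (card (occupied n c)) + remaining_mean n p c"
\<comment> \<open>The bounds on \<open>p\<close> are part of \<open>P\<close> because
  \<open>p\<close> is an argument of the induction.\<close>
proof (induction n p c rule: final_config.induct[where P = "\<lambda>n p c. 0 \<le> p \<longrightarrow> p < 1 \<longrightarrow> 
      measure_pmf.expectation (final_config n p c) (\<lambda>c. real (card (occupied n c))) =
      real (card (occupied n c)) + remaining_mean n p c", rule_format])
  case (1 n p c)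
  let ?A = "accessible n c"
  let ?X = "\<lambda>c. real (card (occupied n c))"
  show ?case
  proof (cases "?A = {}")
    case True
    then have "left_accessible n c = {}" "right_accessible n c = {}"
      by (simp_all add: accessible_eq_Un)
    then show ?thesis
      using True by (simp add: final_config.simps remaining_mean_def)
  next
    case False
    define t where "t = (\<lambda>i. p * remaining_mean n p (c(i \<mapsto> Courteous)) +
            (1 - p) * remaining_mean n p (c(i \<mapsto> Selfish)))"
    have inner: "measure_pmf.expectation
        (bind_pmf (manner_pmf p) (\<lambda>m. final_config n p (c(i \<mapsto> m)))) ?X = ?X c + 1 + t i"
      if "i \<in> ?A" for i
    proof -
      from that have i: "i \<in> {1..n}" "c i = None" by (auto simp: accessible_def)
      have IH: "measure_pmf.expectation (final_config n p (c(i \<mapsto> m))) ?X =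
          ?X c + 1 + remaining_mean n p (c(i \<mapsto> m))" if "m \<in> set_pmf (manner_pmf p)" for m
        using 1 False \<open>i \<in> ?A\<close> that i by (simp add: card_occupied_upd)
      have "measure_pmf.expectation
          (bind_pmf (manner_pmf p) (\<lambda>m. final_config n p (c(i \<mapsto> m)))) ?X =
        measure_pmf.expectation (manner_pmf p)
          (\<lambda>m. measure_pmf.expectation (final_config n p (c(i \<mapsto> m))) ?X)"
        by (rule expectation_bind_pmf_bounded[where B = "real n"]) (simp add: card_occupied_le)
      \<comment> \<open>\<open>IH\<close> covers only manners in the support, so the integrands are
        compared almost everywhere.\<close>
      also have "\<dots> = measure_pmf.expectation (manner_pmf p)
          (\<lambda>m. ?X c + 1 + remaining_mean n p (c(i \<mapsto> m)))"
        by (intro integral_cong_AE) (simp_all add: AE_measure_pmf_iff IH)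
      also have "\<dots> = ?X c + 1 + t i"
        using 1 by (simp add: expectation_manner_pmf t_def algebra_simps)
      finally show ?thesis .
    qed
    have "measure_pmf.expectation (final_config n p c) ?X =
        measure_pmf.expectation (pmf_of_set ?A) (\<lambda>i. measure_pmf.expectation
          (bind_pmf (manner_pmf p) (\<lambda>m. final_config n p (c(i \<mapsto> m)))) ?X)"
      unfolding final_config.simps[of n p c] using False
      by (simp, intro expectation_bind_pmf_bounded[where B = "real n"]) (simp add: card_occupied_le)
    also have "\<dots> = (\<Sum>i\<in>?A. ?X c + 1 + t i) / real (card ?A)"
      using False by (simp add: integral_pmf_of_set inner)
    also have "\<dots> = ?X c + 1 + sum t ?A / real (card ?A)"
      using False by (simp add: sum.distrib field_simps)
    also have "sum t ?A = real (card ?A) * (remaining_mean n p c - 1)"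
      using remaining_mean_step_no_selfish[of p n c] remaining_mean_step_selfish[of p n c] 1
      unfolding t_def by fastforce
    finally show ?thesis
      using False by simp
  qed
qed (use assms in auto)

lemma expected_occupied_eq:
  assumes "0 \<le> p" "p < 1"
  shows "expected_occupied p n = two_entrance_mean p n"
proof -
  have "accessible n (\<lambda>_. None) = {1..n}" "occupied n (\<lambda>_. None) = {}"
    by (auto simp: accessible_def occupied_def)
  moreover have "no_selfish n (\<lambda>_. None)"
    by (simp add: no_selfish_def)
  ultimately show ?thesis
    using expectation_final_config[OF assms]
    by (simp add: expected_occupied_def remaining_mean_def)
qed

subsection \<open>Asymptotics\<close>

text \<open>Splitting \<open>1 - p ^ k\<close> leaves \<open>harm n\<close> and a partial sum of the
  logarithm series for \<open>ln (1 - p)\<close>.\<close>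

lemma one_entrance_mean_asymp:
  assumes "0 < p" "p < 1"
  shows "(\<lambda>n. one_entrance_mean p n - (harm n + ln (1 - p)) / (1 - p)) \<longlonglongrightarrow> 0"
proof -
  have "(\<lambda>k. - ((- (- p)) ^ k) / of_nat k) sums ln (1 + (- p))"
    by (rule ln_series') (use assms in auto)
  then have "(\<lambda>n. \<Sum>k\<le>n. - (p ^ k) / real k) \<longlonglongrightarrow> ln (1 - p)"
    by (simp add: sums_def_le)
  then have "(\<lambda>n. ((\<Sum>k\<le>n. - (p ^ k) / real k) - ln (1 - p)) / (1 - p)) \<longlonglongrightarrow>
      (ln (1 - p) - ln (1 - p)) / (1 - p)"
    by (intro tendsto_intros) (use assms in auto)
  moreover have "((\<Sum>k\<le>n. - (p ^ k) / real k) - ln (1 - p)) / (1 - p) =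
      one_entrance_mean p n - (harm n + ln (1 - p)) / (1 - p)" for n
  proof -
    \<comment> \<open>The term at \<open>k = 0\<close> is a division by zero, hence 0.\<close>
    have "(\<Sum>k\<le>n. - (p ^ k) / real k) = (\<Sum>k=1..n. - (p ^ k) / real k)"
      by (rule sum.mono_neutral_right) (auto simp: not_less_eq_eq)
    then have "harm n + (\<Sum>k\<le>n. - (p ^ k) / real k) = (\<Sum>k=1..n. (1 - p ^ k) / real k)"
      by (simp add: harm_def inverse_eq_divide diff_divide_distrib flip: sum.distrib)
    then have "one_entrance_mean p n = (harm n + (\<Sum>k\<le>n. - (p ^ k) / real k)) / (1 - p)"
      by (simp add: one_entrance_mean_def sum_divide_distrib)
    then show ?thesis by (simp add: diff_divide_distrib add_divide_distrib)
  qed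
  ultimately show ?thesis by simp
qed

theorem theorem4:
  fixes p :: real
  assumes "0 < p" and "p < 1"
  shows "(\<forall>n\<ge>1. expected_occupied p n =
            - ((1 - p ^ n) / (1 - p)) + 2 * (\<Sum>k=1..n. (1 - p ^ k) / (real k * (1 - p))))
       \<and> (\<lambda>n. expected_occupied p n -
            (- (1 / (1 - p)) + 2 * ((harm n + ln (1 - p)) / (1 - p)))) \<in> o(\<lambda>_. 1)"
proof
  show "\<forall>n\<ge>1. expected_occupied p n =
            - ((1 - p ^ n) / (1 - p)) + 2 * (\<Sum>k=1..n. (1 - p ^ k) / (real k * (1 - p)))"
    using assms by (simp add: expected_occupied_eq two_entrance_mean_def one_entrance_mean_def)
next
  \<comment> \<open>The error is twice the one-entrance error plus \<open>p ^ n / (1 - p)\<close>,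
    the decaying part of the correction term.\<close>
  have "(\<lambda>n. p ^ n / (1 - p) + 2 * (one_entrance_mean p n - (harm n + ln (1 - p)) / (1 - p)))
      \<longlonglongrightarrow> 0 / (1 - p) + 2 * 0"
    by (intro tendsto_intros one_entrance_mean_asymp LIMSEQ_realpow_zero) (use assms in auto)
  also have "(\<lambda>n. p ^ n / (1 - p) + 2 * (one_entrance_mean p n - (harm n + ln (1 - p)) / (1 - p))) =
      (\<lambda>n. expected_occupied p n - (- (1 / (1 - p)) + 2 * ((harm n + ln (1 - p)) / (1 - p))))"
    using assms by (simp add: expected_occupied_eq two_entrance_mean_def diff_divide_distrib)
  finally show "(\<lambda>n. expected_occupied p n -
      (- (1 / (1 - p)) + 2 * ((harm n + ln (1 - p)) / (1 - p)))) \<in> o(\<lambda>_. 1)"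
    by (intro smalloI_tendsto) simp_all
qed

end
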